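(* Let $\mathscr{H}$ be a complex Hilbert space, let $T_1, T_2\in \mathbb{B}(\mathscr{H})$ and $\varepsilon\in[0, 1)$. Then the following statements are equivalent: (i) $T_1\parallel^{\varepsilon} T_2$; (ii) $T_1^*\parallel^{\varepsilon} T_2^*$; (iii) $\alpha T_1\parallel^{\varepsilon} \beta T_2$ for all $\alpha, \beta\in\mathbb{C}\smallsetminus\{0\}$; (iv) $\sup\{|(T_1\xi\mid \eta)|:\, \xi,\eta\in\mathscr{H},\ \|\xi\|=\|\eta\|=1, \ (T_2\xi\mid \eta)=0\}\leq\varepsilon\|T_1\|$. Moreover, each of the conditions (i), (ii), (iii), (iv) implies (v) $|(T_1\xi\mid T_2\xi)|^2\geq\|T_1\xi\|^2\|T_2\xi\|^2-\varepsilon^2\|T_1\|^2\|T_2\|^2$ for all $\xi\in\mathscr{H}$ with $\|\xi\|=1$.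
   Context: $\mathbb{B}(\mathscr{H})$ is the $C^*$-algebra of bounded linear operators on $\mathscr{H}$ with the operator norm; $(\cdot\mid\cdot)$ is the inner product of $\mathscr{H}$. For elements $x,y$ of a complex normed space and $\varepsilon\in[0,1)$, $x\parallel^{\varepsilon} y$ ($x$ is $\varepsilon$-parallel to $y$) means that $\inf\{\|x+\mu y\| :\, \mu\in\mathbb{C}\}\leq\varepsilon\|x\|$; here this is used in $\mathbb{B}(\mathscr{H})$ with the operator norm. *)

theory Defs
  imports "HOL-Analysis.Analysis"
begin

class complex_normed_vector = real_normed_vector +
  fixes scaleC :: "complex \<Rightarrow> 'a \<Rightarrow> 'a" (infixr "*\<^sub>C" 75)
  assumes scaleC_add_right: "c *\<^sub>C (x + y) = c *\<^sub>C x + c *\<^sub>C y"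
    and scaleC_add_left: "(c + d) *\<^sub>C x = c *\<^sub>C x + d *\<^sub>C x"
    and scaleC_scaleC: "c *\<^sub>C (d *\<^sub>C x) = (c * d) *\<^sub>C x"
    and scaleC_of_real: "complex_of_real r *\<^sub>C x = r *\<^sub>R x"
    and norm_scaleC: "norm (c *\<^sub>C x) = cmod c * norm x"

lemma scaleC_one [simp]: "1 *\<^sub>C (x::'a::complex_normed_vector) = x"
  using scaleC_of_real[of 1 x] by simp

text \<open>The inner product is linear in the first argument. The axiom \<open>cinner_self\<close> says that
  the norm is the one induced by the inner product; positive definiteness follows from it.\<close>

class complex_inner = complex_normed_vector +
  fixes cinner :: "'a \<Rightarrow> 'a \<Rightarrow> complex"
  assumes cinner_commute: "cinner y x = cnj (cinner x y)"
    and cinner_add_left: "cinner (x + y) z = cinner x z + cinner y z"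
    and cinner_scaleC_left: "cinner (c *\<^sub>C x) y = c * cinner x y"
    and cinner_self: "cinner x x = complex_of_real ((norm x)\<^sup>2)"

class complex_hilbert_space = complex_inner + complete_space

instantiation complex :: complex_hilbert_space
begin
definition scaleC_complex :: "complex \<Rightarrow> complex \<Rightarrow> complex"
  where "scaleC_complex c x = c * x"
definition cinner_complex :: "complex \<Rightarrow> complex \<Rightarrow> complex"
  where "cinner_complex x y = x * cnj y"
instance
  by standard
    (simp_all add: scaleC_complex_def cinner_complex_def algebra_simps norm_mult
      scaleR_conv_of_real complex_norm_square del: of_real_power)
end

text \<open>The library type \<open>'a \<Rightarrow>\<^sub>L 'b\<close> of bounded real-linear maps, normed by the operator norm,
  is a complex normed space under pointwise scalar multiplication.\<close>

instantiation blinfun :: (real_normed_vector, complex_normed_vector) complex_normed_vector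
begin
lift_definition scaleC_blinfun :: "complex \<Rightarrow> ('a \<Rightarrow>\<^sub>L 'b) \<Rightarrow> ('a \<Rightarrow>\<^sub>L 'b)"
  is "\<lambda>c f x. c *\<^sub>C f x"
proof -
  fix c :: complex and f :: "'a \<Rightarrow> 'b"
  assume "bounded_linear f"
  moreover have "bounded_linear (\<lambda>y::'b. c *\<^sub>C y)"
    by (rule bounded_linear_intro[where K = "cmod c"])
      (simp_all add: scaleC_add_right norm_scaleC scaleC_scaleC mult.commute
        flip: scaleC_of_real)
  ultimately show "bounded_linear (\<lambda>x. c *\<^sub>C f x)"
    by (rule bounded_linear_compose[rotated])
qed
instance
proof
  fix c d :: complex and r :: real and f g :: "'a \<Rightarrow>\<^sub>L 'b"
  show "c *\<^sub>C (f + g) = c *\<^sub>C f + c *\<^sub>C g"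
    by transfer (simp add: scaleC_add_right)
  show "(c + d) *\<^sub>C f = c *\<^sub>C f + d *\<^sub>C f"
    by transfer (simp add: scaleC_add_left)
  show "c *\<^sub>C (d *\<^sub>C f) = (c * d) *\<^sub>C f"
    by transfer (simp add: scaleC_scaleC)
  show "complex_of_real r *\<^sub>C f = r *\<^sub>R f"
    by transfer (simp add: scaleC_of_real)
  show "norm (c *\<^sub>C f) = cmod c * norm f"
  proof (rule antisym)
    have le: "norm (a *\<^sub>C h) \<le> cmod a * norm h" for a and h :: "'a \<Rightarrow>\<^sub>L 'b"
      by (rule norm_blinfun_bound)
        (auto simp: scaleC_blinfun.rep_eq norm_scaleC mult.assoc
          intro!: mult_left_mono norm_blinfun)
    show "norm (c *\<^sub>C f) \<le> cmod c * norm f" by (rule le)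
    show "cmod c * norm f \<le> norm (c *\<^sub>C f)"
    proof (cases "c = 0")
      case False
      have "f = inverse c *\<^sub>C (c *\<^sub>C f)"
        using False
        by (intro blinfun_eqI) (simp add: scaleC_blinfun.rep_eq scaleC_scaleC)
      then have "norm f \<le> cmod (inverse c) * norm (c *\<^sub>C f)"
        using le[of "inverse c" "c *\<^sub>C f"] by simp
      with False show ?thesis by (simp add: norm_inverse norm_divide field_simps)
    qed simp
  qed
qed
end

text \<open>The space of bounded complex-linear operators on \<open>'a\<close>, as a complex subspace of
  \<open>'a \<Rightarrow>\<^sub>L 'a\<close>.\<close>

definition bounded_operators :: "('a::complex_normed_vector \<Rightarrow>\<^sub>L 'a) set" where
  "bounded_operators =
    {T. \<forall>c x. blinfun_apply T (c *\<^sub>C x) = c *\<^sub>C blinfun_apply T x}"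

text \<open>For \<open>T\<close> in \<open>bounded_operators\<close> on a Hilbert space, existence of the operator below is the
  usual consequence of the Riesz representation theorem.\<close>

definition cadjoint :: "('a::complex_hilbert_space \<Rightarrow>\<^sub>L 'a) \<Rightarrow> ('a \<Rightarrow>\<^sub>L 'a)" where
  "cadjoint T = (THE S. S \<in> bounded_operators \<and>
    (\<forall>x y. cinner (blinfun_apply T x) y = cinner x (blinfun_apply S y)))"

definition eps_parallel :: "real \<Rightarrow> 'a::complex_normed_vector \<Rightarrow> 'a \<Rightarrow> bool" where
  "eps_parallel \<epsilon> x y \<longleftrightarrow> Inf {norm (x + \<mu> *\<^sub>C y) |\<mu>. True} \<le> \<epsilon> * norm x"

end

theory Submission imports Defs begin

text \<open>
  The distance from an element to a complex line is attained, so \<open>T\<^sub>1\<close> is \<open>\<epsilon>\<close>-parallel to \<open>T\<^sub>2\<close> if and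
  only if some \<open>\<parallel>T\<^sub>1 + \<mu> T\<^sub>2\<parallel>\<close> is at most \<open>\<epsilon> \<parallel>T\<^sub>1\<parallel>\<close> (\<open>eps_parallel_iff\<close>). In this form the condition
  visibly survives nonzero scalings and, since the adjoint is a conjugate-linear isometric involution,
  passage to adjoints. It also gives (v): the Gram determinant of \<open>T\<^sub>1 \<xi>\<close> and \<open>T\<^sub>2 \<xi>\<close> does
  not change when \<open>T\<^sub>1 \<xi>\<close> is replaced by \<open>(T\<^sub>1 + \<mu> T\<^sub>2) \<xi>\<close>, and it is at most the product of the
  squared norms.

  The substance is the equivalence with (iv). When \<open>T\<^sub>2 \<xi>\<close> is orthogonal to \<open>\<eta>\<close>, the number
  \<open>(T\<^sub>1 \<xi> | \<eta>)\<close> is unchanged under \<open>T\<^sub>1 \<mapsto> T\<^sub>1 + \<mu> T\<^sub>2\<close>, so the supremum in (iv) is at most the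
  distance from \<open>T\<^sub>1\<close> to the line through \<open>T\<^sub>2\<close>. For the converse let \<open>A = T\<^sub>1 + \<mu> T\<^sub>2\<close> realise this
  distance and write \<open>B\<close> for \<open>T\<^sub>2\<close>. In finite dimension a theorem of Bhatia and Semrl gives a unit
  vector \<open>\<xi>\<close> with \<open>\<parallel>A \<xi>\<parallel> = \<parallel>A\<parallel>\<close> and \<open>A \<xi>\<close> orthogonal to \<open>B \<xi>\<close>, and \<open>\<eta> = A \<xi> / \<parallel>A\<parallel>\<close> finishes. In
  general there are only unit vectors \<open>\<xi>\<^sub>n\<close> with \<open>\<parallel>A \<xi>\<^sub>n\<parallel> \<rightarrow> \<parallel>A\<parallel>\<close> and \<open>(A \<xi>\<^sub>n | B \<xi>\<^sub>n) \<rightarrow> 0\<close>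
  (\<open>minimal_imp_asymptotically_orthogonal\<close>). They come from a Toeplitz--Hausdorff argument: the
  limits of \<open>(A \<xi> | B \<xi>)\<close> along norming sequences of unit vectors form a closed convex set, and if
  this set missed \<open>0\<close>, a separating half-plane would show a direction \<open>\<mu>\<close> in which
  \<open>\<parallel>A + \<mu> B\<parallel>\<close> drops below \<open>\<parallel>A\<parallel>\<close>.

  Asymptotic orthogonality must then be turned into exact orthogonality (\<open>minimal_norm_le\<close>). If
  \<open>\<parallel>B \<xi>\<^sub>n\<parallel>\<close> stays away from \<open>0\<close>, removing from \<open>A \<xi>\<^sub>n\<close> its component along \<open>B \<xi>\<^sub>n\<close> costs little.
  If \<open>B \<xi>\<^sub>n \<rightarrow> 0\<close> the direction of \<open>B \<xi>\<^sub>n\<close> is uncontrolled, and \<open>\<xi>\<^sub>n\<close> itself is perturbed by a small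
  multiple of a fixed vector \<open>f\<close> with \<open>B f \<noteq> 0\<close>, chosen so as to make the image under \<open>B\<close>
  almost or exactly orthogonal to \<open>A \<xi>\<^sub>n\<close>.
\<close>

section \<open>Complex inner products\<close>

lemma cinner_add_right: "cinner x (y + z) = cinner x y + cinner x z"
  by (metis cinner_add_left cinner_commute complex_cnj_add)

lemma cinner_scaleC_right: "cinner x (c *\<^sub>C y) = cnj c * cinner x y"
  by (metis cinner_scaleC_left cinner_commute complex_cnj_mult)

lemma cinner_cauchy_schwarz: "cmod (cinner x y) \<le> norm x * norm y"
proof (cases "norm y = 0")
  case True
  then have "0 *\<^sub>C y = y" using norm_scaleC[of 0 y] by simp
  then have "cinner x y = 0" using cinner_scaleC_right[of x 0 y] by simp
  then show ?thesis by simp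
next
  case False
  define c where "c = - cinner x y / (norm y)\<^sup>2"
  have xy: "cinner x y = - c * (norm y)\<^sup>2" using False by (simp add: c_def)
  have yx: "cinner y x = - cnj c * (norm y)\<^sup>2"
    using xy by (simp add: cinner_commute[of y x])
  have "cinner (x + c *\<^sub>C y) (x + c *\<^sub>C y) = (norm x)\<^sup>2 - (c * cnj c) * (norm y)\<^sup>2"
    by (simp only: cinner_add_left cinner_add_right cinner_scaleC_left cinner_scaleC_right xy yx)
      (simp add: cinner_self algebra_simps)
  also have "c * cnj c = complex_of_real ((cmod c)\<^sup>2)"
    by (simp only: complex_norm_square)
  finally have "complex_of_real ((norm (x + c *\<^sub>C y))\<^sup>2) =
      complex_of_real ((norm x)\<^sup>2 - (cmod c)\<^sup>2 * (norm y)\<^sup>2)"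
    by (simp add: cinner_self)
  then have "(norm (x + c *\<^sub>C y))\<^sup>2 = (norm x)\<^sup>2 - (cmod c)\<^sup>2 * (norm y)\<^sup>2"
    using of_real_eq_iff by blast
  then have "(cmod c * norm y)\<^sup>2 \<le> (norm x)\<^sup>2"
    by (smt (verit) power_mult_distrib zero_le_power2)
  then have "cmod c * norm y \<le> norm x"
    by (rule power2_le_imp_le) simp
  then have "cmod c * norm y * norm y \<le> norm x * norm y"
    by (intro mult_right_mono) auto
  then show ?thesis by (simp add: xy norm_mult power2_eq_square)
qed

lemma norm_cinner_le:
  assumes "norm x \<le> a" and "norm y \<le> b"
  shows "cmod (cinner x y) \<le> a * b"
  using cinner_cauchy_schwarz[of x y] mult_mono[OF assms] norm_ge_zero[of x] norm_ge_zero[of y] assms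
  by linarith

lemma bounded_bilinear_cinner:
  "bounded_bilinear (cinner :: 'a::complex_inner \<Rightarrow> 'a \<Rightarrow> complex)"
proof
  fix x y z :: 'a and r :: real
  show "cinner (x + y) z = cinner x z + cinner y z"
    by (rule cinner_add_left)
  show "cinner x (y + z) = cinner x y + cinner x z"
    by (rule cinner_add_right)
  show "cinner (r *\<^sub>R x) y = r *\<^sub>R cinner x y"
    by (simp add: cinner_scaleC_left scaleR_conv_of_real flip: scaleC_of_real)
  show "cinner x (r *\<^sub>R y) = r *\<^sub>R cinner x y"
    by (simp add: cinner_scaleC_right scaleR_conv_of_real flip: scaleC_of_real)
  show "\<exists>K. \<forall>a b :: 'a. cmod (cinner a b) \<le> norm a * norm b * K"
    by (intro exI[of _ 1]) (simp add: cinner_cauchy_schwarz)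
qed

interpretation cinner: bounded_bilinear "cinner :: 'a::complex_inner \<Rightarrow> 'a \<Rightarrow> complex"
  by (rule bounded_bilinear_cinner)

lemma bounded_bilinear_scaleC:
  "bounded_bilinear (scaleC :: complex \<Rightarrow> 'a::complex_normed_vector \<Rightarrow> 'a)"
proof
  fix c d :: complex and x y :: 'a and r :: real
  show "(c + d) *\<^sub>C x = c *\<^sub>C x + d *\<^sub>C x" by (rule scaleC_add_left)
  show "c *\<^sub>C (x + y) = c *\<^sub>C x + c *\<^sub>C y" by (rule scaleC_add_right)
  show "(r *\<^sub>R c) *\<^sub>C x = r *\<^sub>R (c *\<^sub>C x)"
    by (simp add: scaleR_conv_of_real scaleC_scaleC flip: scaleC_of_real)
  show "c *\<^sub>C (r *\<^sub>R x) = r *\<^sub>R (c *\<^sub>C x)"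
    by (simp add: scaleC_scaleC mult.commute flip: scaleC_of_real)
  show "\<exists>K. \<forall>c (x::'a). norm (c *\<^sub>C x) \<le> norm c * norm x * K"
    by (intro exI[of _ 1]) (simp add: norm_scaleC)
qed

interpretation scaleC:
  bounded_bilinear "scaleC :: complex \<Rightarrow> 'a::complex_normed_vector \<Rightarrow> 'a"
  by (rule bounded_bilinear_scaleC)

lemma power2_norm_eq_cinner: "(norm x)\<^sup>2 = Re (cinner x x)"
  by (simp add: cinner_self del: of_real_power)

lemma Re_cinner_commute: "Re (cinner y x) = Re (cinner x y)"
  by (simp add: cinner_commute[of y x])

lemma power2_norm_add:
  "(norm (x + y :: 'a::complex_inner))\<^sup>2 = (norm x)\<^sup>2 + (norm y)\<^sup>2 + 2 * Re (cinner x y)"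
  by (simp add: power2_norm_eq_cinner cinner.add_left cinner.add_right Re_cinner_commute[of y x])

lemma power2_norm_convex_combination:
  "(norm ((1 - t) *\<^sub>R x + t *\<^sub>R y :: 'a::complex_inner))\<^sup>2 =
    (1 - t) * (norm x)\<^sup>2 + t * (norm y)\<^sup>2 - t * (1 - t) * (norm (x - y))\<^sup>2"
  by (simp add: power2_norm_eq_cinner cinner.add_left cinner.add_right cinner.diff_left
      cinner.diff_right cinner.scaleR_left cinner.scaleR_right Re_cinner_commute[of y x])
    (simp add: algebra_simps)

lemma cinner_eqI:
  assumes "\<And>x. cinner x y = cinner x (z :: 'a::complex_inner)"
  shows "y = z"
proof -
  have "cinner (y - z) (y - z) = 0"
    by (simp add: cinner.diff_right assms)
  then have "(norm (y - z))\<^sup>2 = 0" by (simp add: power2_norm_eq_cinner)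
  then show ?thesis by simp
qed

section \<open>Adjoints\<close>

text \<open>The representing vector is the minimiser of \<open>J x = \<parallel>x\<parallel>\<^sup>2 - 2 Re (f x)\<close>: by the
  parallelogram law every minimising sequence is Cauchy, and the first variation of \<open>J\<close> at its
  limit \<open>z\<close> is \<open>2 Re ((h | z) - f h)\<close>.\<close>

lemma riesz_representation:
  fixes f :: "'a::complex_hilbert_space \<Rightarrow> complex"
  assumes bl: "bounded_linear f" and hom: "\<And>c x. f (c *\<^sub>C x) = c * f x"
  shows "\<exists>z. \<forall>x. f x = cinner x z"
proof -
  interpret f: bounded_linear f by (rule bl)
  define J where "J x = (norm x)\<^sup>2 - 2 * Re (f x)" for x
  obtain K where K: "\<And>x. cmod (f x) \<le> norm x * K"
    using f.bounded by blast
  have below: "- K\<^sup>2 \<le> J x" for x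
  proof -
    have "Re (f x) \<le> norm x * K"
      using K[of x] complex_Re_le_cmod[of "f x"] by linarith
    moreover have "0 \<le> (norm x - K)\<^sup>2" by simp
    ultimately show ?thesis by (simp add: J_def power2_diff)
  qed
  then have bdd: "bdd_below (range J)" by (auto simp: bdd_below_def)
  define m where "m = Inf (range J)"
  have m_le: "m \<le> J x" for x unfolding m_def by (rule cINF_lower[OF bdd]) simp
  have "\<exists>x. J x < m + 1 / real (Suc n)" for n
    using cInf_lessD[of "range J" "m + 1 / real (Suc n)"] by (auto simp: m_def)
  then obtain X where X: "\<And>n. J (X n) < m + 1 / real (Suc n)" by metis
  have gap: "(norm (x - y))\<^sup>2 \<le> 2 * (J x - m) + 2 * (J y - m)" for x y
  proof -
    have "(norm ((1 - 1/2) *\<^sub>R x + (1/2) *\<^sub>R y))\<^sup>2 =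
        (norm x)\<^sup>2 / 2 + (norm y)\<^sup>2 / 2 - (norm (x - y))\<^sup>2 / 4"
      unfolding power2_norm_convex_combination by simp
    moreover have "Re (f ((1 - 1/2) *\<^sub>R x + (1/2) *\<^sub>R y)) = Re (f x) / 2 + Re (f y) / 2"
      unfolding f.add f.scaleR by simp
    ultimately show ?thesis
      using m_le[of "(1 - 1/2) *\<^sub>R x + (1/2) *\<^sub>R y"] unfolding J_def by argo
  qed
  have "Cauchy X"
  proof (rule CauchyI)
    fix e :: real assume e: "0 < e"
    then obtain N where N: "4 / e\<^sup>2 < real N" using reals_Archimedean2 by blast
    have "norm (X i - X j) < e" if "i \<ge> N" "j \<ge> N" for i j
    proof -
      have N0: "0 < real N" using N e by (smt (verit) divide_pos_pos zero_less_power)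
      have small: "J (X k) - m < 1 / real N" if "k \<ge> N" for k
      proof -
        have "1 / real (Suc k) \<le> 1 / real N"
          using that N0 by (intro divide_left_mono) auto
        then show ?thesis using X[of k] by linarith
      qed
      have "(norm (X i - X j))\<^sup>2 < 4 / real N"
        using gap[of "X i" "X j"] small[OF that(1)] small[OF that(2)] by argo
      also have "\<dots> < e\<^sup>2" using N N0 e by (simp add: field_simps)
      finally show ?thesis using e by (simp add: power_less_imp_less_base)
    qed
    then show "\<exists>N. \<forall>i\<ge>N. \<forall>j\<ge>N. norm (X i - X j) < e" by blast
  qed
  then obtain z where z: "X \<longlonglongrightarrow> z" using Cauchy_convergent_iff convergent_def by blast
  have "(\<lambda>n. J (X n)) \<longlonglongrightarrow> J z"
    unfolding J_def by (intro tendsto_intros f.tendsto z)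
  moreover have "(\<lambda>n. m + 1 / real (Suc n)) \<longlonglongrightarrow> m + 0"
    using LIMSEQ_inverse_real_of_nat by (intro tendsto_intros) (simp add: inverse_eq_divide)
  ultimately have "J z \<le> m + 0"
    by (rule LIMSEQ_le) (use X less_imp_le in blast)
  then have min: "J z \<le> J (z + h)" for h using m_le[of "z + h"] by simp
  have variation: "0 \<le> (norm h)\<^sup>2 + 2 * Re (cinner h z - f h)" for h
    using min[of h] by (simp add: J_def power2_norm_add f.add Re_cinner_commute[of z h])
  have "f x = cinner x z" for x
  proof (rule ccontr)
    define e where "e = cinner x z - f x"
    assume "f x \<noteq> cinner x z"
    then have e0: "cmod e > 0" by (simp add: e_def)
    \<comment> \<open>Along \<open>h = - t * cnj e *\<^sub>C x\<close> the increment of \<open>J\<close> is \<open>t\<^sup>2 \<bar>e\<bar>\<^sup>2 \<parallel>x\<parallel>\<^sup>2 - 2 t \<bar>e\<bar>\<^sup>2\<close>, and this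
      \<open>t\<close> is small enough for the linear term to win.\<close>
    define t where "t = 1 / (1 + (norm x)\<^sup>2)"
    have pos: "1 + (norm x)\<^sup>2 > 0" by (smt (verit) zero_le_power2)
    have t0: "t > 0" using pos by (simp add: t_def)
    define c where "c = - of_real t * cnj e"
    have "cinner (c *\<^sub>C x) z - f (c *\<^sub>C x) = c * e"
      by (simp add: e_def cinner_scaleC_left hom algebra_simps)
    also have "\<dots> = - of_real (t * (cmod e)\<^sup>2)"
      by (simp add: c_def complex_norm_square mult.commute del: of_real_power)
    finally have "Re (cinner (c *\<^sub>C x) z - f (c *\<^sub>C x)) = - t * (cmod e)\<^sup>2" by simp
    moreover have "(norm (c *\<^sub>C x))\<^sup>2 = t\<^sup>2 * (cmod e)\<^sup>2 * (norm x)\<^sup>2"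
      by (simp add: c_def norm_scaleC norm_mult power_mult_distrib)
    ultimately have "0 \<le> t\<^sup>2 * (cmod e)\<^sup>2 * (norm x)\<^sup>2 - 2 * t * (cmod e)\<^sup>2"
      using variation[of "c *\<^sub>C x"] by simp
    also have "\<dots> = t * (cmod e)\<^sup>2 * (t * (norm x)\<^sup>2 - 2)"
      by (simp add: algebra_simps power2_eq_square)
    finally have "0 \<le> (t * (cmod e)\<^sup>2) * (t * (norm x)\<^sup>2 - 2)" .
    moreover have "0 < t * (cmod e)\<^sup>2" using e0 t0 by simp
    ultimately have "2 \<le> t * (norm x)\<^sup>2"
      by (simp only: zero_le_mult_iff) linarith
    then show False using pos by (simp add: t_def field_simps)
  qed
  then show ?thesis by blast
qed

lemma bounded_operatorsD:
  "T \<in> bounded_operators \<Longrightarrow> blinfun_apply T (c *\<^sub>C x) = c *\<^sub>C blinfun_apply T x"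
  by (simp add: bounded_operators_def)

lemma bounded_operators_add_scaleC:
  "A \<in> bounded_operators \<Longrightarrow> B \<in> bounded_operators \<Longrightarrow> A + \<mu> *\<^sub>C B \<in> bounded_operators"
  by (auto simp: bounded_operators_def plus_blinfun.rep_eq scaleC_blinfun.rep_eq
      scaleC_add_right scaleC_scaleC mult.commute)

lemma adjoint_exists:
  fixes T :: "'a::complex_hilbert_space \<Rightarrow>\<^sub>L 'a"
  assumes T: "T \<in> bounded_operators"
  shows "\<exists>S. S \<in> bounded_operators \<and>
    (\<forall>x y. cinner (blinfun_apply T x) y = cinner x (blinfun_apply S y))"
proof -
  have "\<exists>z. \<forall>x. cinner (blinfun_apply T x) y = cinner x z" for y
    by (rule riesz_representation)
      (auto intro!: bounded_linear_compose[OF cinner.bounded_linear_left blinfun.bounded_linear_right]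
        simp: bounded_operatorsD[OF T] cinner_scaleC_left)
  then obtain S where S: "\<And>x y. cinner (blinfun_apply T x) y = cinner x (S y)" by metis
  have scale: "S (c *\<^sub>C y) = c *\<^sub>C S y" for c y
    by (rule cinner_eqI) (simp add: cinner_scaleC_right flip: S)
  have "bounded_linear S"
  proof (rule bounded_linear_intro[where K = "norm T"])
    show "S (x + y) = S x + S y" for x y
      by (rule cinner_eqI) (simp add: cinner.add_right flip: S)
    show "S (r *\<^sub>R x) = r *\<^sub>R S x" for r x
      by (simp add: scale flip: scaleC_of_real)
    fix y
    have "norm (S y) * norm (S y) = Re (cinner (blinfun_apply T (S y)) y)"
      by (simp add: S power2_norm_eq_cinner flip: power2_eq_square)
    also have "\<dots> \<le> norm (blinfun_apply T (S y)) * norm y"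
      using cinner_cauchy_schwarz complex_Re_le_cmod order_trans by blast
    also have "\<dots> \<le> norm T * norm (S y) * norm y"
      by (intro mult_right_mono norm_blinfun) simp
    finally have "norm (S y) * norm (S y) \<le> (norm y * norm T) * norm (S y)"
      by (simp add: ac_simps)
    then show "norm (S y) \<le> norm y * norm T"
      by (metis mult_le_cancel_right norm_ge_zero norm_not_less_zero order_le_less
          zero_le_mult_iff)
  qed
  then show ?thesis
    by (intro exI[of _ "Blinfun S"])
      (auto simp: bounded_operators_def bounded_linear_Blinfun_apply scale S)
qed

lemma
  fixes T :: "'a::complex_hilbert_space \<Rightarrow>\<^sub>L 'a"
  assumes T: "T \<in> bounded_operators"
  shows cadjoint_in_bounded_operators: "cadjoint T \<in> bounded_operators"
    and cinner_cadjoint: "cinner (blinfun_apply T x) y = cinner x (blinfun_apply (cadjoint T) y)"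
proof -
  have "\<exists>!S. S \<in> bounded_operators \<and>
    (\<forall>x y. cinner (blinfun_apply T x) y = cinner x (blinfun_apply S y))"
  proof (rule ex_ex1I[OF adjoint_exists[OF T]])
    fix S R
    assume "S \<in> bounded_operators \<and>
        (\<forall>x y. cinner (blinfun_apply T x) y = cinner x (blinfun_apply S y))"
      and "R \<in> bounded_operators \<and>
        (\<forall>x y. cinner (blinfun_apply T x) y = cinner x (blinfun_apply R y))"
    then have "cinner x (blinfun_apply S y) = cinner x (blinfun_apply R y)" for x y
      by (elim conjE allE[of _ x] allE[of _ y]) (rule trans[OF sym])
    then show "S = R"
      by (rule blinfun_eqI[OF cinner_eqI])
  qed
  from theI'[OF this] show "cadjoint T \<in> bounded_operators"
    "cinner (blinfun_apply T x) y = cinner x (blinfun_apply (cadjoint T) y)"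
    unfolding cadjoint_def by blast+
qed

lemma cadjoint_eqI:
  assumes "T \<in> bounded_operators"
    and "\<And>x y. cinner (blinfun_apply T x) y = cinner x (blinfun_apply S y)"
  shows "cadjoint T = S"
  by (rule blinfun_eqI, rule cinner_eqI) (simp add: assms(2) flip: cinner_cadjoint[OF assms(1)])

lemma cadjoint_cadjoint:
  assumes T: "T \<in> bounded_operators"
  shows "cadjoint (cadjoint T) = T"
proof (rule cadjoint_eqI[OF cadjoint_in_bounded_operators[OF T]])
  fix x y
  have "cinner (blinfun_apply (cadjoint T) x) y = cnj (cinner (blinfun_apply T y) x)"
    by (simp add: cinner_cadjoint[OF T] flip: cinner_commute)
  then show "cinner (blinfun_apply (cadjoint T) x) y = cinner x (blinfun_apply T y)"
    by (simp flip: cinner_commute)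
qed

lemma cadjoint_add_scaleC:
  assumes A: "A \<in> bounded_operators" and B: "B \<in> bounded_operators"
  shows "cadjoint (A + \<mu> *\<^sub>C B) = cadjoint A + cnj \<mu> *\<^sub>C cadjoint B"
  by (rule cadjoint_eqI[OF bounded_operators_add_scaleC[OF A B]])
    (simp add: plus_blinfun.rep_eq scaleC_blinfun.rep_eq cinner.add_left cinner.add_right
      cinner_scaleC_left cinner_scaleC_right cinner_cadjoint A B)

lemma norm_cadjoint:
  assumes T: "T \<in> bounded_operators"
  shows "norm (cadjoint T) = norm T"
proof -
  have le: "norm (cadjoint S) \<le> norm S" if S: "S \<in> bounded_operators" for S :: "'a \<Rightarrow>\<^sub>L 'a"
  proof (rule norm_blinfun_bound)
    fix y
    let ?z = "blinfun_apply (cadjoint S) y"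
    have "norm ?z * norm ?z = Re (cinner (blinfun_apply S ?z) y)"
      by (simp add: cinner_cadjoint[OF S] power2_norm_eq_cinner flip: power2_eq_square)
    also have "\<dots> \<le> norm (blinfun_apply S ?z) * norm y"
      using cinner_cauchy_schwarz complex_Re_le_cmod order_trans by blast
    also have "\<dots> \<le> norm S * norm ?z * norm y"
      by (intro mult_right_mono norm_blinfun) simp
    finally have "norm ?z * norm ?z \<le> (norm S * norm y) * norm ?z"
      by (simp add: ac_simps)
    then show "norm ?z \<le> norm S * norm y"
      by (cases "norm ?z = 0") auto
  qed simp
  show ?thesis
    using le[OF T] le[OF cadjoint_in_bounded_operators[OF T]] by (simp add: cadjoint_cadjoint T)
qed

section \<open>Approximate parallelism\<close>

text \<open>Coefficients \<open>\<mu>\<close> with \<open>\<parallel>\<mu> y\<parallel> \<ge> 2 \<parallel>x\<parallel>\<close> do no better than \<open>\<mu> = 0\<close>, so the infimum may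
  be taken over a compact disc when \<open>y \<noteq> 0\<close>.\<close>

lemma distance_to_line_attained:
  fixes x y :: "'a::complex_normed_vector"
  shows "\<exists>\<mu>\<^sub>0. \<forall>\<mu>. norm (x + \<mu>\<^sub>0 *\<^sub>C y) \<le> norm (x + \<mu> *\<^sub>C y)"
proof (cases "y = 0")
  case True
  then show ?thesis by (simp add: scaleC.zero_right)
next
  case False
  define R where "R = 2 * norm x / norm y"
  have R: "R \<ge> 0" by (simp add: R_def)
  have "continuous_on (cball 0 R) (\<lambda>\<mu>. norm (x + \<mu> *\<^sub>C y))"
    by (intro continuous_intros scaleC.continuous_on)
  then obtain m where m: "m \<in> cball 0 R"
    "\<And>\<mu>. \<mu> \<in> cball 0 R \<Longrightarrow> norm (x + m *\<^sub>C y) \<le> norm (x + \<mu> *\<^sub>C y)"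
    using continuous_attains_inf[of "cball 0 R"] R by (metis centre_in_cball compact_cball empty_iff)
  have "norm (x + m *\<^sub>C y) \<le> norm (x + \<mu> *\<^sub>C y)" for \<mu>
  proof (cases "cmod \<mu> \<le> R")
    case True
    then show ?thesis by (simp add: m(2))
  next
    case outside: False
    then have "2 * norm x \<le> norm (\<mu> *\<^sub>C y)"
      using False by (simp add: norm_scaleC R_def field_simps)
    then have "norm x \<le> norm (x + \<mu> *\<^sub>C y)"
      using norm_diff_ineq[of "\<mu> *\<^sub>C y" x] by (simp add: add.commute)
    moreover have "norm (x + m *\<^sub>C y) \<le> norm x"
      using m(2)[of 0] R by (simp add: scaleC.zero_left)
    ultimately show ?thesis by linarith
  qed
  then show ?thesis by blast
qed

lemma eps_parallel_iff:
  "eps_parallel \<epsilon> x y \<longleftrightarrow> (\<exists>\<mu>. norm (x + \<mu> *\<^sub>C y) \<le> \<epsilon> * norm x)"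
proof -
  let ?D = "{norm (x + \<mu> *\<^sub>C y) |\<mu>. True}"
  obtain m where m: "\<And>\<mu>. norm (x + m *\<^sub>C y) \<le> norm (x + \<mu> *\<^sub>C y)"
    using distance_to_line_attained by blast
  have "Inf ?D = norm (x + m *\<^sub>C y)"
    by (rule cInf_eq_minimum) (auto intro: m)
  then show ?thesis
    unfolding eps_parallel_def using m order_trans by metis
qed

lemma eps_parallel_scaleC:
  assumes "\<alpha> \<noteq> 0" "\<beta> \<noteq> 0" and "eps_parallel \<epsilon> x y"
  shows "eps_parallel \<epsilon> (\<alpha> *\<^sub>C x) (\<beta> *\<^sub>C y)"
proof -
  obtain \<mu> where \<mu>: "norm (x + \<mu> *\<^sub>C y) \<le> \<epsilon> * norm x"
    using assms(3) by (auto simp: eps_parallel_iff)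
  have "\<alpha> *\<^sub>C x + (\<alpha> * \<mu> / \<beta>) *\<^sub>C \<beta> *\<^sub>C y = \<alpha> *\<^sub>C (x + \<mu> *\<^sub>C y)"
    using assms(2) by (simp add: scaleC_scaleC scaleC_add_right)
  then have "norm (\<alpha> *\<^sub>C x + (\<alpha> * \<mu> / \<beta>) *\<^sub>C \<beta> *\<^sub>C y) \<le> \<epsilon> * norm (\<alpha> *\<^sub>C x)"
    using mult_left_mono[OF \<mu>, of "cmod \<alpha>"] by (simp add: norm_scaleC ac_simps)
  then show ?thesis unfolding eps_parallel_iff by blast
qed

lemma eps_parallel_cadjoint:
  assumes "A \<in> bounded_operators" "B \<in> bounded_operators" and "eps_parallel \<epsilon> A B"
  shows "eps_parallel \<epsilon> (cadjoint A) (cadjoint B)"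
proof -
  obtain \<mu> where "norm (A + \<mu> *\<^sub>C B) \<le> \<epsilon> * norm A"
    using assms(3) by (auto simp: eps_parallel_iff)
  then have "norm (cadjoint A + cnj \<mu> *\<^sub>C cadjoint B) \<le> \<epsilon> * norm (cadjoint A)"
    using assms(1,2)
    by (simp add: norm_cadjoint bounded_operators_add_scaleC flip: cadjoint_add_scaleC)
  then show ?thesis unfolding eps_parallel_iff by blast
qed

text \<open>The left-hand side is the Gram determinant of \<open>x\<close> and \<open>y\<close>. It equals that of \<open>x + \<mu> y\<close>
  and \<open>y\<close>, from which \<open>\<bar>(x + \<mu> y | y)\<bar>\<^sup>2\<close> is dropped to get the bound.\<close>

lemma gram_determinant_le:
  fixes x y :: "'a::complex_inner"
  shows "(norm x)\<^sup>2 * (norm y)\<^sup>2 - (cmod (cinner x y))\<^sup>2 \<le> (norm (x + \<mu> *\<^sub>C y))\<^sup>2 * (norm y)\<^sup>2"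
proof -
  define a where "a = cinner x y"
  define n where "n = (norm y)\<^sup>2"
  have yx: "cinner y x = cnj a" by (simp add: a_def flip: cinner_commute)
  have "cmod (a + \<mu> * of_real n) ^ 2 = (cmod a)\<^sup>2 + (cmod \<mu>)\<^sup>2 * n\<^sup>2 + 2 * n * Re (cnj \<mu> * a)"
    unfolding cmod_power2 by (simp add: power2_eq_square algebra_simps)
  moreover have "(norm (x + \<mu> *\<^sub>C y))\<^sup>2 = (norm x)\<^sup>2 + (cmod \<mu>)\<^sup>2 * n + 2 * Re (cnj \<mu> * a)"
    by (simp add: power2_norm_add norm_scaleC power_mult_distrib cinner_scaleC_right a_def n_def)
  ultimately have "(norm (x + \<mu> *\<^sub>C y))\<^sup>2 * n = (norm x)\<^sup>2 * n - (cmod a)\<^sup>2 + (cmod (a + \<mu> * of_real n))\<^sup>2"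
    by (simp add: algebra_simps power2_eq_square)
  then show ?thesis by (simp add: a_def n_def)
qed

lemma eps_parallel_imp_gram_le:
  fixes A B :: "'a::complex_inner \<Rightarrow>\<^sub>L 'a"
  assumes "eps_parallel \<epsilon> A B" and "norm \<xi> = 1"
  shows "(norm (blinfun_apply A \<xi>))\<^sup>2 * (norm (blinfun_apply B \<xi>))\<^sup>2
      - \<epsilon>\<^sup>2 * (norm A)\<^sup>2 * (norm B)\<^sup>2
    \<le> (cmod (cinner (blinfun_apply A \<xi>) (blinfun_apply B \<xi>)))\<^sup>2"
proof -
  obtain \<mu> where \<mu>: "norm (A + \<mu> *\<^sub>C B) \<le> \<epsilon> * norm A"
    using assms(1) by (auto simp: eps_parallel_iff)
  have "norm (blinfun_apply A \<xi> + \<mu> *\<^sub>C blinfun_apply B \<xi>) \<le> \<epsilon> * norm A"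
    using norm_blinfun[of "A + \<mu> *\<^sub>C B" \<xi>] \<mu> assms(2)
    by (simp add: plus_blinfun.rep_eq scaleC_blinfun.rep_eq)
  moreover have "norm (blinfun_apply B \<xi>) \<le> norm B"
    using norm_blinfun[of B \<xi>] assms(2) by simp
  ultimately have "(norm (blinfun_apply A \<xi> + \<mu> *\<^sub>C blinfun_apply B \<xi>))\<^sup>2
      * (norm (blinfun_apply B \<xi>))\<^sup>2 \<le> (\<epsilon> * norm A)\<^sup>2 * (norm B)\<^sup>2"
    by (intro mult_mono power_mono) auto
  then show ?thesis
    using gram_determinant_le[of "blinfun_apply A \<xi>" "blinfun_apply B \<xi>" \<mu>]
    by (simp add: power_mult_distrib)
qed

section \<open>The maximal joint numerical range\<close>

definition almost_norming :: "('a::complex_inner \<Rightarrow>\<^sub>L 'a) \<Rightarrow> real \<Rightarrow> 'a set" where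
  "almost_norming A \<delta> = {x. norm x = 1 \<and> (norm A)\<^sup>2 - \<delta> \<le> (norm (blinfun_apply A x))\<^sup>2}"

text \<open>For \<open>B\<close> the identity this is Stampfli's maximal numerical range of \<open>A\<close>: the limits of \<open>(A \<xi>\<^sub>n | B \<xi>\<^sub>n)\<close> over unit
  vectors \<open>\<xi>\<^sub>n\<close> with \<open>\<parallel>A \<xi>\<^sub>n\<parallel> \<rightarrow> \<parallel>A\<parallel>\<close>. As an intersection of closures it is closed by construction,
  without a diagonal argument on sequences.\<close>

definition maximal_range :: "('a::complex_inner \<Rightarrow>\<^sub>L 'a) \<Rightarrow> ('a \<Rightarrow>\<^sub>L 'a) \<Rightarrow> complex set" where
  "maximal_range A B =
    (\<Inter>\<delta>\<in>{0<..}. closure ((\<lambda>x. cinner (blinfun_apply A x) (blinfun_apply B x)) ` almost_norming A \<delta>))"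

text \<open>Replacing \<open>c\<close> by \<open>- c\<close> keeps the first two conditions, so the sign is free for the third.\<close>

lemma unimodular_phase:
  fixes v r :: complex
  shows "\<exists>c. cmod c = 1 \<and> Im (c * v) = 0 \<and> Re (c * r) \<ge> 0"
proof -
  define b where "b = (if v = 0 then 1 else cnj v / cmod v)"
  have b: "cmod b = 1" "Im (b * v) = 0"
    by (auto simp: b_def norm_divide)
  show ?thesis
  proof (cases "Re (b * r) \<ge> 0")
    case True
    then show ?thesis using b by blast
  next
    case False
    then show ?thesis using b by (intro exI[of _ "- b"]) auto
  qed
qed

text \<open>The Toeplitz--Hausdorff argument. After an affine normalisation the form takes the values
  \<open>0\<close> and \<open>1\<close> at the two vectors, and for a suitable phase \<open>c\<close> it is real along the segment from
  \<open>\<xi>\<close> to \<open>c \<eta>\<close>, where the intermediate value theorem applies. The phase is free up to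
  sign, and choosing the sign so that \<open>Re (c \<eta> | \<xi>) \<ge> 0\<close> keeps the segment away from \<open>0\<close>. The
  convex combination and the bound \<open>1 / 2\<close> are part of the conclusion because they show that
  normalising \<open>x\<close> keeps it almost norming.\<close>

lemma segment_of_form_values:
  fixes A B :: "'a::complex_inner \<Rightarrow>\<^sub>L 'a"
  assumes A: "A \<in> bounded_operators" and B: "B \<in> bounded_operators"
    and unit: "norm \<xi> = 1" "norm \<eta> = 1" and u: "0 \<le> u" "u \<le> 1"
  defines "w \<equiv> \<lambda>x. cinner (blinfun_apply A x) (blinfun_apply B x)"
  shows "\<exists>c t x. cmod c = 1 \<and> 0 \<le> t \<and> t \<le> 1 \<and> x = (1 - t) *\<^sub>R \<xi> + t *\<^sub>R c *\<^sub>C \<eta> \<and>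
    1 / 2 \<le> (norm x)\<^sup>2 \<and> w x = (norm x)\<^sup>2 *\<^sub>R ((1 - u) *\<^sub>R w \<xi> + u *\<^sub>R w \<eta>)"
proof (cases "w \<eta> = w \<xi>")
  case True
  then show ?thesis
    using unit by (intro exI[of _ 1] exI[of _ 0] exI[of _ \<xi>]) (auto simp: algebra_simps)
next
  case False
  define \<Delta> where "\<Delta> = w \<eta> - w \<xi>"
  have \<Delta>: "\<Delta> \<noteq> 0" using False by (simp add: \<Delta>_def)
  \<comment> \<open>The affine normalisation for which \<open>F \<xi> \<xi> = 0\<close> and \<open>F \<eta> \<eta> = 1\<close>.\<close>
  define F where "F x y = (cinner (blinfun_apply A x) (blinfun_apply B y) - w \<xi> * cinner x y) / \<Delta>"
    for x y
  have F_add_l: "F (x + y) z = F x z + F y z" and F_add_r: "F z (x + y) = F z x + F z y" for x y z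
    by (simp_all add: F_def blinfun.add_right cinner.add_left cinner.add_right
        add_divide_distrib diff_divide_distrib algebra_simps)
  have F_scaleC_l: "F (c *\<^sub>C x) z = c * F x z" and F_scaleC_r: "F z (c *\<^sub>C x) = cnj c * F z x"
    for c x z
    by (simp_all add: F_def bounded_operatorsD A B cinner_scaleC_left cinner_scaleC_right
        algebra_simps)
  have F_self: "w x = w \<xi> * (norm x)\<^sup>2 + \<Delta> * F x x" for x
    using \<Delta> by (simp add: F_def w_def cinner_self)
  have F\<xi>: "F \<xi> \<xi> = 0" and F\<eta>: "F \<eta> \<eta> = 1"
    using \<Delta> unit by (simp_all add: F_def cinner_self w_def \<Delta>_def)
  obtain c where c: "cmod c = 1" "Im (c * (F \<eta> \<xi> - cnj (F \<xi> \<eta>))) = 0"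
      "Re (c * cinner \<eta> \<xi>) \<ge> 0"
    using unimodular_phase by blast
  define k where "k = Re (cnj c * F \<xi> \<eta> + c * F \<eta> \<xi>)"
  have cross: "cnj c * F \<xi> \<eta> + c * F \<eta> \<xi> = of_real k"
  proof (rule complex_eqI)
    show "Im (cnj c * F \<xi> \<eta> + c * F \<eta> \<xi>) = Im (complex_of_real k)"
      using c(2) by (simp add: algebra_simps)
  qed (simp add: k_def)
  have cc: "c * cnj c = 1" using c(1) by (simp add: flip: complex_norm_square)
  define x where "x t = (1 - t) *\<^sub>R \<xi> + t *\<^sub>R c *\<^sub>C \<eta>" for t :: real
  have F_x: "F (x t) (x t) = of_real (t\<^sup>2 + t * (1 - t) * k)" for t
  proof -
    have "F (x t) (x t) = of_real (1 - t) * of_real t * (cnj c * F \<xi> \<eta> + c * F \<eta> \<xi>)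
        + (of_real t)\<^sup>2 * (c * cnj c)"
      unfolding x_def scaleC_of_real[symmetric]
      by (simp only: F_add_l F_add_r F_scaleC_l F_scaleC_r F\<xi> F\<eta>)
        (simp add: algebra_simps power2_eq_square)
    then show ?thesis unfolding cross cc by (simp add: algebra_simps)
  qed
  have norm_x: "1 / 2 \<le> (norm (x t))\<^sup>2" if "0 \<le> t" "t \<le> 1" for t
  proof -
    have "(norm (x t))\<^sup>2 = (1 - t)\<^sup>2 + t\<^sup>2 + 2 * (t * (1 - t) * Re (c * cinner \<eta> \<xi>))"
      by (simp add: x_def power2_norm_add unit norm_scaleC c(1) cinner.scaleR_left
          cinner.scaleR_right Re_cinner_commute[of "c *\<^sub>C \<eta>" \<xi>, symmetric] cinner_scaleC_left
          power_mult_distrib del: times_complex.sel)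
    moreover have "0 \<le> t * (1 - t) * Re (c * cinner \<eta> \<xi>)" using that c(3) by simp
    moreover have "1 / 2 \<le> (1 - t)\<^sup>2 + t\<^sup>2"
      using zero_le_power2[of "1 - 2 * t"] by (simp add: power2_eq_square algebra_simps)
    ultimately show ?thesis by linarith
  qed
  define g where "g t = (t\<^sup>2 + t * (1 - t) * k) / (norm (x t))\<^sup>2" for t
  have "continuous_on {0..1} g"
    unfolding g_def using norm_x
    by (intro continuous_intros) (auto simp: x_def intro!: continuous_intros, force)
  moreover have "g 0 = 0" "g 1 = 1"
    by (simp_all add: g_def x_def unit norm_scaleC c(1))
  ultimately obtain t where t: "0 \<le> t" "t \<le> 1" "g t = u"
    using IVT'[of g 0 u 1] u by auto
  have "t\<^sup>2 + t * (1 - t) * k = u * (norm (x t))\<^sup>2"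
    using norm_x[OF t(1,2)] unfolding t(3)[symmetric] g_def by auto
  then have "w (x t) = w \<xi> * (norm (x t))\<^sup>2 + \<Delta> * of_real (u * (norm (x t))\<^sup>2)"
    using F_self[of "x t"] F_x[of t] by simp
  also have "\<dots> = (norm (x t))\<^sup>2 *\<^sub>R ((1 - u) *\<^sub>R w \<xi> + u *\<^sub>R w \<eta>)"
    by (simp add: \<Delta>_def scaleR_conv_of_real algebra_simps)
  finally show ?thesis
    using c(1) t norm_x[OF t(1,2)] unfolding x_def by blast
qed

text \<open>The defect \<open>q x = \<parallel>A\<parallel>\<^sup>2 \<parallel>x\<parallel>\<^sup>2 - \<parallel>A x\<parallel>\<^sup>2\<close> is a nonnegative quadratic form, hence convex, so it
  is at most \<open>\<delta>\<close> along the segment; normalising a vector of squared norm at least \<open>1 / 2\<close> at most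
  doubles it.\<close>

lemma almost_norming_segment:
  fixes A B :: "'a::complex_inner \<Rightarrow>\<^sub>L 'a"
  assumes A: "A \<in> bounded_operators" and B: "B \<in> bounded_operators"
    and near: "\<xi> \<in> almost_norming A \<delta>" "\<eta> \<in> almost_norming A \<delta>"
    and \<delta>: "0 \<le> \<delta>" and u: "0 \<le> u" "u \<le> 1"
  defines "w \<equiv> \<lambda>x. cinner (blinfun_apply A x) (blinfun_apply B x)"
  shows "(1 - u) *\<^sub>R w \<xi> + u *\<^sub>R w \<eta> \<in> w ` almost_norming A (2 * \<delta>)"
proof -
  define q where "q x = (norm A)\<^sup>2 * (norm x)\<^sup>2 - (norm (blinfun_apply A x))\<^sup>2" for x
  have q_nonneg: "0 \<le> q x" for x
    using power_mono[OF norm_blinfun[of A x], of 2] by (simp add: q_def power_mult_distrib)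
  have unit: "norm \<xi> = 1" "norm \<eta> = 1" using near by (auto simp: almost_norming_def)
  obtain c t x where x: "cmod c = 1" "0 \<le> t" "t \<le> 1" "x = (1 - t) *\<^sub>R \<xi> + t *\<^sub>R c *\<^sub>C \<eta>"
    "1 / 2 \<le> (norm x)\<^sup>2" "w x = (norm x)\<^sup>2 *\<^sub>R ((1 - u) *\<^sub>R w \<xi> + u *\<^sub>R w \<eta>)"
    using segment_of_form_values[OF A B unit u] unfolding w_def by blast
  have "q \<xi> \<le> \<delta>" "q (c *\<^sub>C \<eta>) \<le> \<delta>"
    using near x(1)
    by (auto simp: q_def almost_norming_def norm_scaleC bounded_operatorsD[OF A])
  then have "(1 - t) * q \<xi> + t * q (c *\<^sub>C \<eta>) \<le> \<delta>"
    using x(2,3) by (intro convex_bound_le) auto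
  moreover have "q x = (1 - t) * q \<xi> + t * q (c *\<^sub>C \<eta>) - t * (1 - t) * q (\<xi> - c *\<^sub>C \<eta>)"
    unfolding q_def x(4) blinfun.add_right blinfun.scaleR_right blinfun.diff_right
      power2_norm_convex_combination by (simp add: algebra_simps)
  moreover have "0 \<le> t * (1 - t) * q (\<xi> - c *\<^sub>C \<eta>)"
    using x(2,3) q_nonneg by simp
  ultimately have q_x: "q x \<le> \<delta>" by linarith
  define r where "r = norm x"
  define y where "y = (1 / r) *\<^sub>R x"
  have r: "0 < r" "1 / 2 \<le> r\<^sup>2" using x(5) by (auto simp: r_def)
  have "norm y = 1" using r by (simp add: y_def r_def)
  moreover have "(norm A)\<^sup>2 - 2 * \<delta> \<le> (norm (blinfun_apply A y))\<^sup>2"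
  proof -
    have "\<delta> \<le> 2 * \<delta> * r\<^sup>2" using mult_left_mono[OF r(2), of "2 * \<delta>"] \<delta> by simp
    then have "((norm A)\<^sup>2 - 2 * \<delta>) * r\<^sup>2 \<le> (norm (blinfun_apply A x))\<^sup>2"
      using q_x by (simp add: q_def r_def algebra_simps)
    then show ?thesis
      using r by (simp add: y_def blinfun.scaleR_right power_divide field_simps)
  qed
  moreover have "w y = (1 - u) *\<^sub>R w \<xi> + u *\<^sub>R w \<eta>"
  proof -
    have "w y = (1 / r\<^sup>2) *\<^sub>R w x"
      by (simp add: w_def y_def blinfun.scaleR_right cinner.scaleR_left cinner.scaleR_right
          power2_eq_square)
    then show ?thesis using r unfolding x(6) by (simp add: r_def)
  qed
  ultimately show ?thesis by (force simp: almost_norming_def)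
qed

lemma convex_maximal_range:
  fixes A B :: "'a::complex_inner \<Rightarrow>\<^sub>L 'a"
  assumes A: "A \<in> bounded_operators" and B: "B \<in> bounded_operators"
  shows "convex (maximal_range A B)"
  unfolding convex_alt
proof (intro ballI allI impI)
  let ?w = "\<lambda>x. cinner (blinfun_apply A x) (blinfun_apply B x)"
  fix p q and u :: real
  assume p: "p \<in> maximal_range A B" and q: "q \<in> maximal_range A B" and u: "0 \<le> u \<and> u \<le> 1"
  show "(1 - u) *\<^sub>R p + u *\<^sub>R q \<in> maximal_range A B"
    unfolding maximal_range_def
  proof
    fix \<delta> :: real assume "\<delta> \<in> {0<..}"
    then have \<delta>: "0 < \<delta> / 2" by simp
    have "p \<in> closure (?w ` almost_norming A (\<delta> / 2))" "q \<in> closure (?w ` almost_norming A (\<delta> / 2))"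
      using p q \<delta> unfolding maximal_range_def by blast+
    then obtain P Q where P: "\<And>n::nat. P n \<in> ?w ` almost_norming A (\<delta> / 2)" "P \<longlonglongrightarrow> p"
      and Q: "\<And>n::nat. Q n \<in> ?w ` almost_norming A (\<delta> / 2)" "Q \<longlonglongrightarrow> q"
      unfolding closure_sequential by blast
    have "(1 - u) *\<^sub>R P n + u *\<^sub>R Q n \<in> ?w ` almost_norming A \<delta>" for n
      using P(1)[of n] Q(1)[of n] almost_norming_segment[OF A B, of _ "\<delta> / 2" _ u] \<delta> u
      by fastforce
    moreover have "(\<lambda>n. (1 - u) *\<^sub>R P n + u *\<^sub>R Q n) \<longlonglongrightarrow> (1 - u) *\<^sub>R p + u *\<^sub>R q"
      by (intro tendsto_intros P Q)
    ultimately show "(1 - u) *\<^sub>R p + u *\<^sub>R q \<in> closure (?w ` almost_norming A \<delta>)"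
      unfolding closure_sequential by (intro exI[of _ "\<lambda>n. (1 - u) *\<^sub>R P n + u *\<^sub>R Q n"]) auto
  qed
qed

lemma closed_maximal_range: "closed (maximal_range A B)"
  unfolding maximal_range_def by (intro closed_INT) auto

lemma almost_norming_nonempty:
  fixes A :: "'a::complex_inner \<Rightarrow>\<^sub>L 'a"
  assumes nontrivial: "(v :: 'a) \<noteq> 0" and \<delta>: "0 < \<delta>"
  shows "almost_norming A \<delta> \<noteq> {}"
proof
  assume "almost_norming A \<delta> = {}"
  then have less: "(norm (blinfun_apply A x))\<^sup>2 < (norm A)\<^sup>2 - \<delta>" if "norm x = 1" for x
    using that by (force simp: almost_norming_def)
  define k where "k = sqrt ((norm A)\<^sup>2 - \<delta>)"
  have pos: "0 < (norm A)\<^sup>2 - \<delta>"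
    using less[of "v /\<^sub>R norm v"] nontrivial by (smt (verit) norm_sgn sgn_div_norm zero_le_power2)
  have "norm A \<le> k"
  proof (rule norm_blinfun_bound)
    show "0 \<le> k" using pos by (simp add: k_def)
    fix x
    show "norm (blinfun_apply A x) \<le> k * norm x"
    proof (cases "x = 0")
      case False
      then have "norm (blinfun_apply A (x /\<^sub>R norm x)) \<le> k"
        unfolding k_def by (intro real_le_rsqrt less_imp_le less) simp
      then show ?thesis using False by (simp add: blinfun.scaleR_right field_simps)
    qed (simp add: blinfun.zero_right)
  qed
  then have "(norm A)\<^sup>2 \<le> k\<^sup>2" by (intro power_mono) auto
  then show False using pos \<delta> by (simp add: k_def)
qed

text \<open>This is the first-order condition for the minimality of \<open>A\<close> in the direction \<open>- a\<close>. For small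
  \<open>t > 0\<close> a vector that nearly norms \<open>A - t a B\<close> satisfies
  \<open>\<parallel>A\<parallel>\<^sup>2 \<le> \<parallel>A x\<parallel>\<^sup>2 - 2 t Re (cnj a (A x | B x)) + O(t\<^sup>2)\<close>. Therefore it nearly norms \<open>A\<close>, and the real
  part is at most \<open>O(t)\<close>.\<close>

lemma maximal_range_meets_half_plane:
  fixes A B :: "'a::complex_inner \<Rightarrow>\<^sub>L 'a"
  assumes min: "\<And>\<mu>. norm A \<le> norm (A + \<mu> *\<^sub>C B)" and nontrivial: "(v :: 'a) \<noteq> 0"
  shows "\<exists>z\<in>maximal_range A B. inner a z \<le> 0"
proof -
  define w where "w x = cinner (blinfun_apply A x) (blinfun_apply B x)" for x
  define C where "C = (cmod a * norm B)\<^sup>2 + 1"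
  define D where "D = 2 * cmod a * norm A * norm B + C"
  have C: "0 < C" unfolding C_def by (smt (verit) zero_le_power2)
  have step: "\<exists>x. norm x = 1 \<and> inner a (w x) \<le> t * C \<and> (norm A)\<^sup>2 - t * D \<le> (norm (blinfun_apply A x))\<^sup>2"
    if t: "0 < t" "t \<le> 1" for t
  proof -
    define \<mu> where "\<mu> = - of_real t * a"
    obtain x where x: "norm x = 1"
      "(norm (A + \<mu> *\<^sub>C B))\<^sup>2 - t\<^sup>2 \<le> (norm (blinfun_apply (A + \<mu> *\<^sub>C B) x))\<^sup>2"
      using almost_norming_nonempty[OF nontrivial, of "t\<^sup>2" "A + \<mu> *\<^sub>C B"] t
      by (auto simp: almost_norming_def)
    have A_x: "norm (blinfun_apply A x) \<le> norm A" and B_x: "norm (blinfun_apply B x) \<le> norm B"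
      using norm_blinfun[of A x] norm_blinfun[of B x] x(1) by simp_all
    have "(norm A)\<^sup>2 - t\<^sup>2 \<le> (norm (blinfun_apply (A + \<mu> *\<^sub>C B) x))\<^sup>2"
      using x(2) power_mono[OF min[of \<mu>] norm_ge_zero, of 2] by linarith
    also have "\<dots> = (norm (blinfun_apply A x))\<^sup>2 + (t * (cmod a * norm (blinfun_apply B x)))\<^sup>2
        - 2 * t * inner a (w x)"
      using t by (simp add: plus_blinfun.rep_eq scaleC_blinfun.rep_eq power2_norm_add norm_scaleC
          cinner_scaleC_right \<mu>_def w_def norm_mult inner_complex_def power_mult_distrib
          algebra_simps)
    also have "(t * (cmod a * norm (blinfun_apply B x)))\<^sup>2 \<le> (t * (cmod a * norm B))\<^sup>2"
      using t B_x by (intro power_mono mult_left_mono) auto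
    finally have main: "(norm A)\<^sup>2 + 2 * t * inner a (w x) \<le> (norm (blinfun_apply A x))\<^sup>2 + t\<^sup>2 * C"
      by (simp add: C_def power_mult_distrib algebra_simps)
    have "2 * t * inner a (w x) \<le> t\<^sup>2 * C"
      using main power_mono[OF A_x norm_ge_zero, of 2] by linarith
    then have "t * (2 * inner a (w x)) \<le> t * (t * C)" by (simp add: power2_eq_square ac_simps)
    then have "2 * inner a (w x) \<le> t * C" using t by simp
    then have upper: "inner a (w x) \<le> t * C" using t C mult_pos_pos[of t C] by linarith
    have "- inner a (w x) \<le> cmod a * cmod (w x)"
      using Cauchy_Schwarz_ineq2[of a "w x"] by linarith
    also have "\<dots> \<le> cmod a * (norm A * norm B)"
      unfolding w_def by (intro mult_left_mono norm_cinner_le A_x B_x) simp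
    finally have lower: "- inner a (w x) \<le> cmod a * (norm A * norm B)" .
    have "- (2 * t * inner a (w x)) \<le> 2 * t * (cmod a * (norm A * norm B))"
      using mult_left_mono[OF lower, of "2 * t"] t by simp
    moreover have "t\<^sup>2 * C \<le> t * C"
      using t C by (intro mult_right_mono) (auto simp: power2_eq_square mult_left_le)
    moreover have "t * D = 2 * t * (cmod a * (norm A * norm B)) + t * C"
      by (simp add: D_def distrib_left mult.assoc mult.left_commute)
    ultimately have "(norm A)\<^sup>2 - t * D \<le> (norm (blinfun_apply A x))\<^sup>2"
      using main by linarith
    then show ?thesis using x(1) upper by blast
  qed
  define \<tau> where "\<tau> n = inverse (real (Suc n))" for n
  have \<tau>: "0 < \<tau> n" "\<tau> n \<le> 1" for n by (auto simp: \<tau>_def inverse_le_1_iff)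
  have \<tau>_lim: "\<tau> \<longlonglongrightarrow> 0" unfolding \<tau>_def by (rule LIMSEQ_inverse_real_of_nat)
  obtain X where X: "\<And>n. norm (X n) = 1" "\<And>n. inner a (w (X n)) \<le> \<tau> n * C"
    "\<And>n. (norm A)\<^sup>2 - \<tau> n * D \<le> (norm (blinfun_apply A (X n)))\<^sup>2"
    using step[OF \<tau>] by metis
  have "norm (w (X n)) \<le> norm A * norm B" for n
    using norm_blinfun[of A "X n"] norm_blinfun[of B "X n"] X(1)[of n]
    unfolding w_def by (intro norm_cinner_le) simp_all
  then have "bounded (range (\<lambda>n. w (X n)))" by (auto simp: bounded_iff)
  then obtain z r where r: "strict_mono r" and z: "(\<lambda>n. w (X (r n))) \<longlonglongrightarrow> z"
    using bounded_imp_convergent_subsequence[of "\<lambda>n. w (X n)"] by (auto simp: o_def)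
  have \<tau>r: "(\<lambda>n. \<tau> (r n) * c) \<longlonglongrightarrow> 0 * c" for c
    using LIMSEQ_subseq_LIMSEQ[OF \<tau>_lim r] by (intro tendsto_intros) (simp add: o_def)
  have "(\<lambda>n. inner a (w (X (r n)))) \<longlonglongrightarrow> inner a z" by (intro tendsto_intros z)
  then have "inner a z \<le> 0 * C" using \<tau>r[of C] by (rule LIMSEQ_le) (use X(2) in blast)
  moreover have "z \<in> maximal_range A B"
    unfolding maximal_range_def
  proof
    fix \<delta> :: real assume "\<delta> \<in> {0<..}"
    then have "\<forall>\<^sub>F n in sequentially. \<tau> (r n) * D < \<delta>"
      using order_tendstoD(2)[OF \<tau>r[of D], of \<delta>] by simp
    then have "\<forall>\<^sub>F n in sequentially. w (X (r n)) \<in> w ` almost_norming A \<delta>"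
    proof eventually_elim
      case (elim n)
      then have "X (r n) \<in> almost_norming A \<delta>"
        using X(1)[of "r n"] X(3)[of "r n"] by (simp add: almost_norming_def)
      then show ?case by blast
    qed
    then have "\<forall>\<^sub>F n in sequentially. w (X (r n)) \<in> closure (w ` almost_norming A \<delta>)"
      by (rule eventually_mono) (rule subsetD[OF closure_subset])
    then have "z \<in> closure (w ` almost_norming A \<delta>)"
      by (rule Lim_in_closed_set[OF closed_closure _ _ z]) simp
    then show "z \<in> closure ((\<lambda>x. cinner (blinfun_apply A x) (blinfun_apply B x)) ` almost_norming A \<delta>)"
      by (simp add: w_def[abs_def])
  qed
  ultimately show ?thesis by auto
qed

lemma zero_in_maximal_range:
  fixes A B :: "'a::complex_inner \<Rightarrow>\<^sub>L 'a"
  assumes A: "A \<in> bounded_operators" and B: "B \<in> bounded_operators"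
    and min: "\<And>\<mu>. norm A \<le> norm (A + \<mu> *\<^sub>C B)" and nontrivial: "(v :: 'a) \<noteq> 0"
  shows "0 \<in> maximal_range A B"
proof (rule ccontr)
  assume "0 \<notin> maximal_range A B"
  then obtain a b where "0 < b" "\<And>z. z \<in> maximal_range A B \<Longrightarrow> inner a z > b"
    using separating_hyperplane_closed_0[OF convex_maximal_range[OF A B] closed_maximal_range]
    by metis
  then show False
    using maximal_range_meets_half_plane[OF min nontrivial, of a] by (metis less_trans not_le)
qed

lemma minimal_imp_asymptotically_orthogonal:
  fixes A B :: "'a::complex_inner \<Rightarrow>\<^sub>L 'a"
  assumes A: "A \<in> bounded_operators" and B: "B \<in> bounded_operators"
    and min: "\<And>\<mu>. norm A \<le> norm (A + \<mu> *\<^sub>C B)" and nontrivial: "(v :: 'a) \<noteq> 0"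
  obtains X :: "nat \<Rightarrow> 'a" where "\<And>n. norm (X n) = 1"
    and "(\<lambda>n. norm (blinfun_apply A (X n))) \<longlonglongrightarrow> norm A"
    and "(\<lambda>n. cinner (blinfun_apply A (X n)) (blinfun_apply B (X n))) \<longlonglongrightarrow> 0"
proof -
  define w where "w x = cinner (blinfun_apply A x) (blinfun_apply B x)" for x
  define \<tau> where "\<tau> n = inverse (real (Suc n))" for n
  have \<tau>: "0 < \<tau> n" for n by (auto simp: \<tau>_def)
  have \<tau>_lim: "\<tau> \<longlonglongrightarrow> 0" unfolding \<tau>_def by (rule LIMSEQ_inverse_real_of_nat)
  have "\<exists>x\<in>almost_norming A (\<tau> n). cmod (w x) < \<tau> n" for n
  proof -
    have "0 \<in> closure (w ` almost_norming A (\<tau> n))"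
      using zero_in_maximal_range[OF A B min nontrivial] \<tau>[of n]
      by (auto simp: maximal_range_def w_def[abs_def])
    then show ?thesis using \<tau>[of n] by (auto simp: closure_approachable)
  qed
  then obtain X where X: "\<And>n. X n \<in> almost_norming A (\<tau> n)" "\<And>n. cmod (w (X n)) < \<tau> n"
    by metis
  have unit: "norm (X n) = 1" for n using X(1)[of n] by (simp add: almost_norming_def)
  have "(\<lambda>n. (norm (blinfun_apply A (X n)))\<^sup>2) \<longlonglongrightarrow> (norm A)\<^sup>2"
  proof (rule real_tendsto_sandwich)
    show "(\<lambda>n. (norm A)\<^sup>2 - \<tau> n) \<longlonglongrightarrow> (norm A)\<^sup>2"
      using tendsto_diff[OF tendsto_const \<tau>_lim, of "(norm A)\<^sup>2"] by simp
    show "\<forall>\<^sub>F n in sequentially. (norm A)\<^sup>2 - \<tau> n \<le> (norm (blinfun_apply A (X n)))\<^sup>2"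
      using X(1) by (simp add: almost_norming_def)
    show "\<forall>\<^sub>F n in sequentially. (norm (blinfun_apply A (X n)))\<^sup>2 \<le> (norm A)\<^sup>2"
      using norm_blinfun[of A "X _"] by (intro always_eventually allI power_mono) (simp_all add: unit)
  qed simp
  then have "(\<lambda>n. sqrt ((norm (blinfun_apply A (X n)))\<^sup>2)) \<longlonglongrightarrow> sqrt ((norm A)\<^sup>2)"
    by (rule tendsto_real_sqrt)
  then have "(\<lambda>n. norm (blinfun_apply A (X n))) \<longlonglongrightarrow> norm A" by simp
  moreover have "(\<lambda>n. w (X n)) \<longlonglongrightarrow> 0"
    by (rule Lim_null_comparison[OF _ \<tau>_lim]) (intro always_eventually allI less_imp_le X(2))
  ultimately show ?thesis using that unit unfolding w_def by blast
qed

section \<open>The distance formula\<close>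

text \<open>Since \<open>\<parallel>y\<parallel>\<^sup>2 = (z | y)\<close>, that is, \<open>y\<close> is the projection of \<open>z\<close> onto the line that it spans, the
  bound on \<open>(A x | y)\<close> controls \<open>\<parallel>y\<parallel>\<close> up to the distance from \<open>A x\<close> to \<open>z\<close>. This distance leaves room
  for perturbing \<open>x\<close> while \<open>z\<close> stays fixed.\<close>

lemma norm_le_of_orthogonal:
  fixes A B :: "'a::complex_inner \<Rightarrow>\<^sub>L 'a"
  assumes bound: "\<forall>x y. cinner (blinfun_apply B x) y = 0 \<longrightarrow>
      cmod (cinner (blinfun_apply A x) y) \<le> s * norm x * norm y"
    and s: "0 \<le> s"
    and orth: "cinner (blinfun_apply B x) y = 0" and part: "cinner z y = (norm y)\<^sup>2"
  shows "norm y \<le> s * norm x + norm (z - blinfun_apply A x)"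
proof (cases "y = 0")
  case True
  then show ?thesis using s by simp
next
  case False
  have "norm y * norm y = cmod (cinner (z - blinfun_apply A x) y + cinner (blinfun_apply A x) y)"
    by (simp add: part norm_mult power2_eq_square flip: cinner.add_left)
  also have "\<dots> \<le> norm (z - blinfun_apply A x) * norm y + s * norm x * norm y"
    by (intro order_trans[OF norm_triangle_ineq] add_mono cinner_cauchy_schwarz bound[rule_format, OF orth])
  also have "\<dots> = (s * norm x + norm (z - blinfun_apply A x)) * norm y"
    by (simp add: algebra_simps)
  finally show ?thesis using False by simp
qed

text \<open>Apply the previous lemma to the component of \<open>y\<close> orthogonal to \<open>B x\<close>; the component
  along \<open>B x\<close> has norm \<open>\<bar>(y | B x)\<bar> / \<parallel>B x\<parallel>\<close>. Multiplying by \<open>\<parallel>B x\<parallel>\<close> makes the estimate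
  suitable for limits.\<close>

lemma norm_le_of_almost_orthogonal:
  fixes A B :: "'a::complex_inner \<Rightarrow>\<^sub>L 'a"
  assumes bound: "\<forall>x y. cinner (blinfun_apply B x) y = 0 \<longrightarrow>
      cmod (cinner (blinfun_apply A x) y) \<le> s * norm x * norm y"
    and s: "0 \<le> s"
  shows "norm y * norm (blinfun_apply B x)
    \<le> (s * norm x + norm (y - blinfun_apply A x)) * norm (blinfun_apply B x)
      + cmod (cinner y (blinfun_apply B x))"
proof (cases "blinfun_apply B x = 0")
  case False
  define b where "b = blinfun_apply B x"
  have b: "norm b > 0" using False by (simp add: b_def)
  define c where "c = cinner y b / (norm b)\<^sup>2"
  define e where "e = y - c *\<^sub>C b"
  have e_b: "cinner e b = 0"
    using b by (simp add: e_def c_def cinner.diff_left cinner_scaleC_left cinner_self)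
  then have b_e: "cinner b e = 0" by (simp add: cinner_commute[of b e])
  have "y = e + c *\<^sub>C b" by (simp add: e_def)
  then have "cinner y e = (norm e)\<^sup>2"
    by (simp add: cinner.add_left cinner_scaleC_left b_e cinner_self)
  then have "norm e \<le> s * norm x + norm (y - blinfun_apply A x)"
    using norm_le_of_orthogonal[OF bound s, where x = x and y = e and z = y] b_e unfolding b_def by simp
  moreover have "norm y \<le> norm e + cmod c * norm b"
    using norm_triangle_ineq[of e "c *\<^sub>C b"] by (simp add: e_def norm_scaleC)
  ultimately have "norm y * norm b \<le> (s * norm x + norm (y - blinfun_apply A x) + cmod c * norm b) * norm b"
    using b by (intro mult_right_mono) auto
  also have "\<dots> = (s * norm x + norm (y - blinfun_apply A x)) * norm b + cmod (cinner y b)"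
    using b by (simp add: c_def norm_divide norm_mult power2_eq_square algebra_simps)
  finally show ?thesis by (simp add: b_def)
qed simp

text \<open>The three cases distinguish what happens to \<open>B \<xi>\<^sub>n\<close> along an asymptotically orthogonal
  sequence. When it tends to \<open>0\<close> the test vector is perturbed to \<open>\<xi>\<^sub>n + c f\<close>. If
  \<open>(A \<xi>\<^sub>n | B f) \<rightarrow> 0\<close>, a fixed small \<open>c\<close> gives a vector whose image under \<open>B\<close> is close to
  \<open>c B f\<close>, which is almost orthogonal to \<open>A \<xi>\<^sub>n\<close> and not small. Otherwise some \<open>c\<^sub>n \<rightarrow> 0\<close> makes the
  image under \<open>B\<close> exactly orthogonal to \<open>A \<xi>\<^sub>n\<close>, and it does not matter whether this image
  vanishes.\<close>

lemma minimal_norm_le: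
  fixes A B :: "'a::complex_inner \<Rightarrow>\<^sub>L 'a"
  assumes A: "A \<in> bounded_operators" and B: "B \<in> bounded_operators"
    and min: "\<And>\<mu>. norm A \<le> norm (A + \<mu> *\<^sub>C B)"
    and s: "0 \<le> s"
    and bound: "\<forall>x y. cinner (blinfun_apply B x) y = 0 \<longrightarrow>
      cmod (cinner (blinfun_apply A x) y) \<le> s * norm x * norm y"
  shows "norm A \<le> s"
proof (cases "B = 0")
  case True
  show ?thesis
  proof (rule norm_blinfun_bound[OF s])
    show "norm (blinfun_apply A x) \<le> s * norm x" for x
      using norm_le_of_orthogonal[OF bound s, where x = x and y = "blinfun_apply A x" and z = "blinfun_apply A x"]
      by (simp add: True cinner.zero_left cinner_self)
  qed
next
  case False
  then obtain f where f: "blinfun_apply B f \<noteq> 0" by (metis blinfun_eqI zero_blinfun.rep_eq)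
  then have nontrivial: "f \<noteq> 0" by (auto simp: blinfun.zero_right)
  define bf where "bf = blinfun_apply B f"
  obtain X where X: "\<And>n. norm (X n) = 1"
    "(\<lambda>n. norm (blinfun_apply A (X n))) \<longlonglongrightarrow> norm A"
    "(\<lambda>n. cinner (blinfun_apply A (X n)) (blinfun_apply B (X n))) \<longlonglongrightarrow> 0"
    using minimal_imp_asymptotically_orthogonal[OF A B min nontrivial] by blast
  \<comment> \<open>One subsequence makes \<open>\<parallel>B \<xi>\<^sub>n\<parallel>\<close> and \<open>(A \<xi>\<^sub>n | B f)\<close> converge together.\<close>
  define G where "G n = (norm (blinfun_apply B (X n)), cinner (blinfun_apply A (X n)) bf)" for n
  have "norm (G n) \<le> norm B + norm A * norm bf" for n
  proof -
    have "cmod (cinner (blinfun_apply A (X n)) bf) \<le> norm A * norm bf"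
      using norm_blinfun[of A "X n"] X(1)[of n] by (intro norm_cinner_le) simp_all
    then show ?thesis
      using norm_Pair_le[of "norm (blinfun_apply B (X n))" "cinner (blinfun_apply A (X n)) bf"]
        norm_blinfun[of B "X n"] X(1)[of n] by (simp add: G_def)
  qed
  then have "bounded (range G)" by (auto simp: bounded_iff)
  then obtain l r where r: "strict_mono r" and l: "(G \<circ> r) \<longlonglongrightarrow> l"
    using bounded_imp_convergent_subsequence by blast
  define Y where "Y n = X (r n)" for n
  define a where "a n = blinfun_apply A (Y n)" for n
  define b where "b n = blinfun_apply B (Y n)" for n
  define \<beta> where "\<beta> = fst l"
  define \<kappa> where "\<kappa> = snd l"
  have Y1: "norm (Y n) = 1" for n by (simp add: Y_def X(1))
  have a_lim: "(\<lambda>n. norm (a n)) \<longlonglongrightarrow> norm A"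
    using LIMSEQ_subseq_LIMSEQ[OF X(2) r] by (simp add: a_def Y_def o_def)
  have ab_lim: "(\<lambda>n. cinner (a n) (b n)) \<longlonglongrightarrow> 0"
    using LIMSEQ_subseq_LIMSEQ[OF X(3) r] by (simp add: a_def b_def Y_def o_def)
  have b_lim: "(\<lambda>n. norm (b n)) \<longlonglongrightarrow> \<beta>"
    using tendsto_fst[OF l] by (simp add: \<beta>_def G_def b_def Y_def o_def)
  have af_lim: "(\<lambda>n. cinner (a n) bf) \<longlonglongrightarrow> \<kappa>"
    using tendsto_snd[OF l] by (simp add: \<kappa>_def G_def a_def Y_def o_def)
  consider "\<beta> \<noteq> 0" | "\<beta> = 0" "\<kappa> = 0" | "\<beta> = 0" "\<kappa> \<noteq> 0" by blast
  then show ?thesis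
  proof cases
    case 1
    have "norm (a n) * norm (b n) \<le> s * norm (b n) + cmod (cinner (a n) (b n))" for n
      using norm_le_of_almost_orthogonal[OF bound s, where y = "a n" and x = "Y n"] by (simp add: a_def b_def Y1)
    moreover have "(\<lambda>n. s * norm (b n) + cmod (cinner (a n) (b n))) \<longlonglongrightarrow> s * \<beta> + cmod 0"
      by (intro tendsto_intros b_lim ab_lim)
    moreover have "(\<lambda>n. norm (a n) * norm (b n)) \<longlonglongrightarrow> norm A * \<beta>"
      by (intro tendsto_intros a_lim b_lim)
    ultimately have "norm A * \<beta> \<le> s * \<beta> + cmod 0" by (blast intro: LIMSEQ_le)
    moreover have "0 < \<beta>"
      using 1 LIMSEQ_le_const[OF b_lim, of 0] by force
    ultimately show ?thesis by simp
  next
    case 2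
    have b0: "b \<longlonglongrightarrow> 0" using b_lim 2(1) by (simp add: tendsto_norm_zero_iff)
    have r_bound: "norm A \<le> s + t * (s * norm f + norm (blinfun_apply A f))" if t: "0 < t" for t :: real
    proof -
      define b' where "b' n = b n + t *\<^sub>R bf" for n
      define K where "K = s * (1 + t * norm f) + t * norm (blinfun_apply A f)"
      have "norm (a n) * norm (b' n) \<le> K * norm (b' n) + cmod (cinner (a n) (b' n))" for n
      proof -
        have "norm (Y n + t *\<^sub>R f) \<le> 1 + t * norm f"
          using norm_triangle_ineq[of "Y n" "t *\<^sub>R f"] t by (simp add: Y1)
        then have "s * norm (Y n + t *\<^sub>R f) + t * norm (blinfun_apply A f) \<le> K"
          unfolding K_def using s by (intro add_right_mono mult_left_mono)
        then have "(s * norm (Y n + t *\<^sub>R f) + t * norm (blinfun_apply A f)) * norm (b' n)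
            \<le> K * norm (b' n)"
          by (intro mult_right_mono) auto
        then show ?thesis
          using norm_le_of_almost_orthogonal[OF bound s, where y = "a n" and x = "Y n + t *\<^sub>R f"] t
          by (simp add: a_def b_def b'_def bf_def blinfun.add_right blinfun.scaleR_right)
      qed
      moreover have "(\<lambda>n. norm (a n) * norm (b' n)) \<longlonglongrightarrow> norm A * norm (0 + t *\<^sub>R bf)"
        unfolding b'_def by (intro tendsto_intros a_lim b0)
      moreover have "(\<lambda>n. K * norm (b' n) + cmod (cinner (a n) (b' n)))
          \<longlonglongrightarrow> K * norm (0 + t *\<^sub>R bf) + cmod (0 + t *\<^sub>R 0)"
        unfolding b'_def cinner.add_right cinner.scaleR_right
        using af_lim 2(2) by (intro tendsto_intros ab_lim b0) simp
      ultimately have "norm A * norm (0 + t *\<^sub>R bf) \<le> K * norm (0 + t *\<^sub>R bf) + cmod (0 + t *\<^sub>R 0)"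
        by (blast intro: LIMSEQ_le)
      then have "norm A \<le> K" using t f by (simp add: bf_def)
      then show ?thesis by (simp add: K_def algebra_simps)
    qed
    show ?thesis
    proof (rule field_le_epsilon)
      fix e :: real assume e: "0 < e"
      define L where "L = s * norm f + norm (blinfun_apply A f) + 1"
      have L: "0 < L" using s by (simp add: L_def add_nonneg_pos)
      have "e / L * (L - 1) \<le> e" using e L by (simp add: field_simps)
      then show "norm A \<le> s + e" using r_bound[of "e / L"] e L by (simp add: L_def)
    qed
  next
    case 3
    have b0: "b \<longlonglongrightarrow> 0" using b_lim 3(1) by (simp add: tendsto_norm_zero_iff)
    define c where "c n = - cnj (cinner (a n) (b n) / cinner (a n) bf)" for n
    have "c \<longlonglongrightarrow> - cnj (0 / \<kappa>)"
      unfolding c_def by (intro tendsto_intros ab_lim af_lim 3)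
    then have c0: "c \<longlonglongrightarrow> 0" by simp
    have "\<forall>\<^sub>F n in sequentially. cinner (a n) bf \<noteq> 0"
      using af_lim 3(2) by (rule tendsto_imp_eventually_ne)
    then have "\<forall>\<^sub>F n in sequentially.
        norm (a n) \<le> s * norm (Y n + c n *\<^sub>C f) + norm (c n *\<^sub>C blinfun_apply A f)"
    proof eventually_elim
      case (elim n)
      have "cinner (a n) (blinfun_apply B (Y n + c n *\<^sub>C f)) = 0"
        using elim
        by (simp add: blinfun.add_right bounded_operatorsD[OF B] cinner.add_right
            cinner_scaleC_right c_def flip: b_def bf_def)
      then have "cinner (blinfun_apply B (Y n + c n *\<^sub>C f)) (a n) = 0"
        by (simp add: cinner_commute[of _ "a n"])
      from norm_le_of_orthogonal[OF bound s this, where z = "a n"] show ?case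
        by (simp add: cinner_self blinfun.add_right bounded_operatorsD[OF A] a_def)
    qed
    then have "\<forall>\<^sub>F n in sequentially.
        norm (a n) \<le> s * (1 + cmod (c n) * norm f) + cmod (c n) * norm (blinfun_apply A f)"
    proof eventually_elim
      case (elim n)
      have "s * norm (Y n + c n *\<^sub>C f) \<le> s * (1 + cmod (c n) * norm f)"
        using norm_triangle_ineq[of "Y n" "c n *\<^sub>C f"] s
        by (intro mult_left_mono) (auto simp: Y1 norm_scaleC)
      then show ?case using elim by (simp add: norm_scaleC)
    qed
    moreover have "(\<lambda>n. s * (1 + cmod (c n) * norm f) + cmod (c n) * norm (blinfun_apply A f))
        \<longlonglongrightarrow> s * (1 + cmod 0 * norm f) + cmod 0 * norm (blinfun_apply A f)"
      by (intro tendsto_intros c0)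
    ultimately have "norm A \<le> s * (1 + cmod 0 * norm f) + cmod 0 * norm (blinfun_apply A f)"
      by (intro tendsto_le[OF _ _ a_lim]) auto
    then show ?thesis by simp
  qed
qed

text \<open>Normalising \<open>x\<close> and \<open>y\<close> turns the supremum into a homogeneous bound. If there are no
  admissible pairs of unit vectors, as can happen in dimension one, the supremum in the
  extended reals is \<open>-\<infinity>\<close>, which matches the fact that the homogeneous
  bound then only concerns \<open>x = 0\<close> or \<open>y = 0\<close>.\<close>

lemma orthogonal_form_bound_iff_Sup:
  fixes A B :: "'a::complex_inner \<Rightarrow>\<^sub>L 'a"
  shows "Sup {ereal (cmod (cinner (blinfun_apply A \<xi>) \<eta>)) |\<xi> \<eta>.
        norm \<xi> = 1 \<and> norm \<eta> = 1 \<and> cinner (blinfun_apply B \<xi>) \<eta> = 0} \<le> ereal s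
    \<longleftrightarrow> (\<forall>x y. cinner (blinfun_apply B x) y = 0 \<longrightarrow>
        cmod (cinner (blinfun_apply A x) y) \<le> s * norm x * norm y)"
    (is "?S \<longleftrightarrow> ?H")
proof
  assume ?H
  then show ?S by (force intro!: Sup_least)
next
  assume ?S
  then have unit: "cmod (cinner (blinfun_apply A \<xi>) \<eta>) \<le> s"
    if "norm \<xi> = 1" "norm \<eta> = 1" "cinner (blinfun_apply B \<xi>) \<eta> = 0" for \<xi> \<eta>
    using that unfolding Sup_le_iff by force
  show ?H
  proof (intro allI impI)
    fix x y assume orth: "cinner (blinfun_apply B x) y = 0"
    show "cmod (cinner (blinfun_apply A x) y) \<le> s * norm x * norm y"
    proof (cases "x = 0 \<or> y = 0")
      case True
      then show ?thesis by (auto simp: blinfun.zero_right cinner.zero_left cinner.zero_right)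
    next
      case False
      then have "cmod (cinner (blinfun_apply A (x /\<^sub>R norm x)) (y /\<^sub>R norm y)) \<le> s"
        by (intro unit)
          (simp_all add: blinfun.scaleR_right cinner.scaleR_left cinner.scaleR_right orth)
      then show ?thesis using False
        by (simp add: blinfun.scaleR_right cinner.scaleR_left cinner.scaleR_right field_simps)
    qed
  qed
qed

lemma eps_parallel_iff_orthogonal_form_bound:
  fixes A B :: "'a::complex_inner \<Rightarrow>\<^sub>L 'a"
  assumes A: "A \<in> bounded_operators" and B: "B \<in> bounded_operators" and \<epsilon>: "0 \<le> \<epsilon>"
  shows "eps_parallel \<epsilon> A B \<longleftrightarrow> (\<forall>x y. cinner (blinfun_apply B x) y = 0 \<longrightarrow>
        cmod (cinner (blinfun_apply A x) y) \<le> \<epsilon> * norm A * norm x * norm y)"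
    (is "_ \<longleftrightarrow> ?H")
proof -
  have form: "cinner (blinfun_apply (A + \<mu> *\<^sub>C B) x) y = cinner (blinfun_apply A x) y"
    if "cinner (blinfun_apply B x) y = 0" for \<mu> x y
    using that
    by (simp add: plus_blinfun.rep_eq scaleC_blinfun.rep_eq cinner.add_left cinner_scaleC_left)
  show ?thesis
  proof
    assume "eps_parallel \<epsilon> A B"
    then obtain \<mu> where \<mu>: "norm (A + \<mu> *\<^sub>C B) \<le> \<epsilon> * norm A" by (auto simp: eps_parallel_iff)
    show ?H
    proof (intro allI impI)
      fix x y assume "cinner (blinfun_apply B x) y = 0"
      then have "cmod (cinner (blinfun_apply A x) y) \<le> norm (blinfun_apply (A + \<mu> *\<^sub>C B) x) * norm y"
        using cinner_cauchy_schwarz[of "blinfun_apply (A + \<mu> *\<^sub>C B) x" y] by (simp add: form)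
      also have "\<dots> \<le> (norm (A + \<mu> *\<^sub>C B) * norm x) * norm y"
        by (intro mult_right_mono norm_blinfun) simp
      also have "\<dots> \<le> (\<epsilon> * norm A * norm x) * norm y"
        by (intro mult_right_mono \<mu>) auto
      finally show "cmod (cinner (blinfun_apply A x) y) \<le> \<epsilon> * norm A * norm x * norm y" .
    qed
  next
    assume H: ?H
    obtain m where m: "\<And>\<mu>. norm (A + m *\<^sub>C B) \<le> norm (A + \<mu> *\<^sub>C B)"
      using distance_to_line_attained by blast
    have "norm (A + m *\<^sub>C B) \<le> \<epsilon> * norm A"
    proof (rule minimal_norm_le[OF bounded_operators_add_scaleC[OF A B] B])
      show "norm (A + m *\<^sub>C B) \<le> norm (A + m *\<^sub>C B + \<mu> *\<^sub>C B)" for \<mu>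
        using m[of "m + \<mu>"] by (simp add: scaleC_add_left add.assoc)
    qed (use H \<epsilon> form in auto)
    then show "eps_parallel \<epsilon> A B" unfolding eps_parallel_iff by blast
  qed
qed

theorem theorem3p7:
  fixes T\<^sub>1 T\<^sub>2 :: "'a::complex_hilbert_space \<Rightarrow>\<^sub>L 'a" and \<epsilon> :: real
  assumes "T\<^sub>1 \<in> bounded_operators" and "T\<^sub>2 \<in> bounded_operators"
    and "0 \<le> \<epsilon>" and "\<epsilon> < 1"
  shows "let
      i = eps_parallel \<epsilon> T\<^sub>1 T\<^sub>2;
      ii = eps_parallel \<epsilon> (cadjoint T\<^sub>1) (cadjoint T\<^sub>2);
      iii = (\<forall>\<alpha> \<beta>. \<alpha> \<noteq> 0 \<and> \<beta> \<noteq> 0 \<longrightarrow> eps_parallel \<epsilon> (\<alpha> *\<^sub>C T\<^sub>1) (\<beta> *\<^sub>C T\<^sub>2));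
      iv = (Sup {ereal (cmod (cinner (blinfun_apply T\<^sub>1 \<xi>) \<eta>)) |\<xi> \<eta>.
              norm \<xi> = 1 \<and> norm \<eta> = 1 \<and> cinner (blinfun_apply T\<^sub>2 \<xi>) \<eta> = 0}
            \<le> ereal (\<epsilon> * norm T\<^sub>1));
      v = (\<forall>\<xi>. norm \<xi> = 1 \<longrightarrow>
            (cmod (cinner (blinfun_apply T\<^sub>1 \<xi>) (blinfun_apply T\<^sub>2 \<xi>)))\<^sup>2
            \<ge> (norm (blinfun_apply T\<^sub>1 \<xi>))\<^sup>2 * (norm (blinfun_apply T\<^sub>2 \<xi>))\<^sup>2
              - \<epsilon>\<^sup>2 * (norm T\<^sub>1)\<^sup>2 * (norm T\<^sub>2)\<^sup>2)
    in (i \<longleftrightarrow> ii) \<and> (i \<longleftrightarrow> iii) \<and> (i \<longleftrightarrow> iv) \<and>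
       (i \<longrightarrow> v) \<and> (ii \<longrightarrow> v) \<and> (iii \<longrightarrow> v) \<and> (iv \<longrightarrow> v)"
proof -
  let ?i = "eps_parallel \<epsilon> T\<^sub>1 T\<^sub>2"
  note T = assms(1,2)
  have ii: "?i \<longleftrightarrow> eps_parallel \<epsilon> (cadjoint T\<^sub>1) (cadjoint T\<^sub>2)"
    using eps_parallel_cadjoint[OF T, of \<epsilon>]
      eps_parallel_cadjoint[OF T[THEN cadjoint_in_bounded_operators], of \<epsilon>]
    by (auto simp: cadjoint_cadjoint T)
  have iii: "?i \<longleftrightarrow> (\<forall>\<alpha> \<beta>. \<alpha> \<noteq> 0 \<and> \<beta> \<noteq> 0 \<longrightarrow> eps_parallel \<epsilon> (\<alpha> *\<^sub>C T\<^sub>1) (\<beta> *\<^sub>C T\<^sub>2))"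
    using eps_parallel_scaleC by (metis scaleC_one zero_neq_one)
  note iv = eps_parallel_iff_orthogonal_form_bound[OF T assms(3),
      folded orthogonal_form_bound_iff_Sup]
  note v = eps_parallel_imp_gram_le[of \<epsilon> T\<^sub>1 T\<^sub>2]
  show ?thesis
    unfolding Let_def ii[symmetric] iii[symmetric] iv[symmetric] using v by blast
qed

end
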